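(* Fix an evidentiary threshold $\tau\in(0,1)$, an improvement ratio $r\in(0,1)$ and a feasibility ceiling $N_{\max}\in\mathbb{Z}_{\ge 1}$. Let $p_{\min}(\tau,N_{\max},r)\in(0,1)$ be the unique solution $p\in(0,1)$ of $\Lambda_0(N_{\max},p)=\tau$, where $\Lambda_0(n,p)=\left[\frac{1-p}{1-rp}\right]^{n}$. To first order it is given by $$p_{\min}(\tau,N_{\max},r)\approx\frac{-\ln\tau}{N_{\max}(1-r)},$$ in the sense that, for fixed $\tau,r$, the ratio of the two sides tends to $1$ as $N_{\max}\to\infty$. Then for every harm category whose rate $p\in(0,1)$ under the scoring rule in use satisfies $p>p_{\min}(\tau,N_{\max},r)$, the finite integer $$n=\left\lceil\frac{\ln\tau}{\ln\left[(1-p)/(1-rp)\right]}\right\rceil$$ satisfies $1\le n\le N_{\max}$, and a zero-harm result on $n$ independent trials moves the posterior odds toward acceptable risk by at least the factor $\tau$, i.e. $\Lambda_0(n,p)\le\tau$, equivalently $O_1\le\tau O_0$ for every prior odds $O_0>0$. Moreover, for fixed $\tau$ and $r$, this required $n$ (a closed-form function of $\tau,r,p$) is $\mathcal{O}(1/p)$: there is a constant $C=C(\tau,r)$ such that $n\le C/p$ for all $p\in(0,1)$.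
   Context: An evaluation consists of $n\ge 1$ independent Bernoulli trials (prompts), each yielding a harmful output with probability equal to the harm rate under a fixed scoring rule. Two hypotheses are compared: $H_1$ (elevated risk), under which the harm rate is $p$, and $H_0$ (acceptable risk), under which the harm rate is $rp$, with $r\in(0,1)$ the improvement ratio. A zero-harm result is the event that none of the $n$ trials is harmful. Its likelihood ratio is $\Lambda_0(n,p)=P(\text{zero harms}\mid H_1)/P(\text{zero harms}\mid H_0)=[(1-p)/(1-rp)]^{n}$. With prior odds $O_0=P(H_1)/P(H_0)$, the posterior odds after a zero-harm result are $O_1=O_0\,\Lambda_0(n,p)$. The feasibility ceiling $N_{\max}$ is the largest allowed number of trials. *)

theory Defs
  imports "HOL-Probability.Probability"
begin

(* Outcome omega of n independent trials: omega i says that the output of prompt i < n is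
   harmful. Indices i >= n carry the dummy value False. *)
definition trials :: "nat \<Rightarrow> real \<Rightarrow> (nat \<Rightarrow> bool) pmf" where
  "trials n \<theta> = Pi_pmf {..<n} False (\<lambda>_. bernoulli_pmf \<theta>)"

definition zero_harm :: "nat \<Rightarrow> (nat \<Rightarrow> bool) \<Rightarrow> bool" where
  "zero_harm n \<omega> \<longleftrightarrow> (\<forall>i<n. \<not> \<omega> i)"

(* H1 has harm rate p, H0 has harm rate r * p. *)
definition likelihood_ratio :: "real \<Rightarrow> nat \<Rightarrow> real \<Rightarrow> real" where
  "likelihood_ratio r n p =
     \<P>(\<omega> in trials n p. zero_harm n \<omega>) / \<P>(\<omega> in trials n (r * p). zero_harm n \<omega>)"

(* Joint law of (is H1 true?, outcome of the trials). The prior odds O0 = P(H1) / P(H0)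
   correspond to the prior probability P(H1) = O0 / (1 + O0). *)
definition evaluation :: "real \<Rightarrow> real \<Rightarrow> nat \<Rightarrow> real \<Rightarrow> (bool \<times> (nat \<Rightarrow> bool)) pmf" where
  "evaluation O0 r n p =
     bind_pmf (bernoulli_pmf (O0 / (1 + O0)))
       (\<lambda>h1. map_pmf (Pair h1) (trials n (if h1 then p else r * p)))"

definition prior_odds :: "real \<Rightarrow> real \<Rightarrow> nat \<Rightarrow> real \<Rightarrow> real" where
  "prior_odds O0 r n p =
     \<P>(x in evaluation O0 r n p. fst x) / \<P>(x in evaluation O0 r n p. \<not> fst x)"

definition posterior_odds :: "real \<Rightarrow> real \<Rightarrow> nat \<Rightarrow> real \<Rightarrow> real" where
  "posterior_odds O0 r n p =
     \<P>(x in evaluation O0 r n p. fst x \<bar> zero_harm n (snd x)) /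
     \<P>(x in evaluation O0 r n p. \<not> fst x \<bar> zero_harm n (snd x))"

definition p_min :: "real \<Rightarrow> nat \<Rightarrow> real \<Rightarrow> real" where
  "p_min \<tau> N r = (THE p. 0 < p \<and> p < 1 \<and> likelihood_ratio r N p = \<tau>)"

definition required_trials :: "real \<Rightarrow> real \<Rightarrow> real \<Rightarrow> int" where
  "required_trials \<tau> r p = \<lceil>ln \<tau> / ln ((1 - p) / (1 - r * p))\<rceil>"

end

theory Submission
  imports Defs "HOL-Real_Asymp.Real_Asymp"
begin

text \<open>Independence gives a zero-harm result probability \<open>(1 - \<theta>) ^ n\<close>, so
  the likelihood ratio is \<open>q ^ n\<close> with \<open>q = (1 - p) / (1 - r * p)\<close> in the
  open unit interval, and Bayes' rule multiplies the odds by it. As \<open>ln q < 0\<close>, the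
  bound \<open>q ^ n \<le> \<tau>\<close> means \<open>n \<ge> ln \<tau> / ln q\<close>, which the
  ceiling meets.

  Sending \<open>p\<close> to \<open>q\<close> is a decreasing involution
  (\<open>single_trial_ratio_less_iff\<close>). It therefore carries the \<open>N\<close>-th root of
  \<open>\<tau>\<close> to \<open>p_min\<close>, whose asymptotics follow from this closed form, and
  it turns \<open>p > p_min\<close> into \<open>q ^ N < \<tau>\<close>, that is,
  \<open>ln \<tau> / ln q < N\<close>. Finally \<open>ln q \<le> q - 1 \<le> - (1 - r) * p\<close>
  bounds the quotient by a multiple of \<open>1 / p\<close>.\<close>

lemma measure_trials_zero_harm:
  assumes "0 \<le> \<theta>" "\<theta> \<le> 1"
  shows "measure_pmf.prob (trials n \<theta>) {\<omega>. zero_harm n \<omega>} = (1 - \<theta>) ^ n"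
proof -
  \<comment> \<open>The event is a box that constrains only the coordinates below \<open>n\<close>,
    so its probability is a product of marginals.\<close>
  have "{\<omega>. zero_harm n \<omega>} = Pi {..<n} (\<lambda>_. {False})"
    by (auto simp: zero_harm_def Pi_def)
  with assms show ?thesis
    by (simp add: trials_def measure_Pi_pmf_Pi measure_pmf_single)
qed

lemma likelihood_ratio_eq:
  assumes "0 < r" "r < 1" "0 < p" "p < 1"
  shows "likelihood_ratio r n p = ((1 - p) / (1 - r * p)) ^ n"
proof -
  have "r * p < 1" using assms mult_strict_mono[of r 1 p 1] by simp
  with assms show ?thesis
    by (simp add: likelihood_ratio_def measure_trials_zero_harm power_divide)
qed

text \<open>Total probability over the two hypotheses, with weights \<open>O0 / (1 + O0)\<close> and
  \<open>1 / (1 + O0)\<close>. The event is arbitrary so that prior, joint and evidence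
  probabilities are all instances.\<close>

lemma measure_evaluation:
  assumes "0 < O0"
  shows "measure_pmf.prob (evaluation O0 r n p) A =
    (O0 * measure_pmf.prob (trials n p) {\<omega>. (True, \<omega>) \<in> A} +
     measure_pmf.prob (trials n (r * p)) {\<omega>. (False, \<omega>) \<in> A}) / (1 + O0)"
proof -
  define w where "w = O0 / (1 + O0)"
  have w: "0 \<le> w" "w \<le> 1" "1 - w = 1 / (1 + O0)"
    using assms by (auto simp: w_def field_simps)
  have "measure_pmf.prob (evaluation O0 r n p) A =
      measure_pmf.expectation (bernoulli_pmf w)
        (\<lambda>h. measure_pmf.prob (map_pmf (Pair h) (trials n (if h then p else r * p))) A)"
    unfolding evaluation_def w_def[symmetric] measure_pmf_bind
    by (rule measure_pmf.measure_bind[where N="count_space UNIV"])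
      (simp_all add: measure_pmf_in_subprob_algebra)
  also have "\<dots> = w * measure_pmf.prob (trials n p) {\<omega>. (True, \<omega>) \<in> A}
      + (1 - w) * measure_pmf.prob (trials n (r * p)) {\<omega>. (False, \<omega>) \<in> A}"
    using w(1,2) by (simp add: vimage_def)
  finally show ?thesis
    unfolding w(3) by (simp add: w_def add_divide_distrib)
qed

lemma prior_odds_eq:
  assumes "0 < O0"
  shows "prior_odds O0 r n p = O0"
  using assms by (simp add: prior_odds_def measure_evaluation)

lemma posterior_odds_eq:
  assumes "0 < r" "r < 1" "0 < p" "p < 1" "0 < O0"
  shows "posterior_odds O0 r n p = O0 * likelihood_ratio r n p"
proof -
  have rp: "r * p < 1" using assms mult_strict_mono[of r 1 p 1] by simp
  have "0 < (1 - p) ^ n" "0 < (1 - r * p) ^ n" using assms rp by simp_all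
  \<comment> \<open>Up to the factor \<open>1 / (1 + O0)\<close> this is the probability of the
    evidence. Being nonzero, it cancels from the two conditional probabilities instead of triggering
    division by zero.\<close>
  then have "0 < O0 * (1 - p) ^ n + (1 - r * p) ^ n"
    using assms by (simp add: add_pos_pos)
  with assms rp show ?thesis
    by (simp add: posterior_odds_def likelihood_ratio_def cond_prob_def
        measure_evaluation measure_trials_zero_harm)
qed

lemma likelihood_ratio_le_iff:
  assumes "0 < r" "r < 1" "0 < p" "p < 1"
  shows "likelihood_ratio r n p \<le> \<tau> \<longleftrightarrow> (\<forall>O0>0. posterior_odds O0 r n p \<le> \<tau> * O0)"
proof -
  have "posterior_odds O0 r n p \<le> \<tau> * O0 \<longleftrightarrow> likelihood_ratio r n p \<le> \<tau>" if "0 < O0" for O0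
    using posterior_odds_eq[OF assms that] that by (simp add: mult.commute[of \<tau>])
  \<comment> \<open>Some positive prior odds must exist for the universally quantified side to imply
    the bound.\<close>
  moreover have "\<exists>O0::real. O0 > 0" using zero_less_one by blast
  ultimately show ?thesis by blast
qed

text \<open>For fixed \<open>r\<close> the map \<open>p \<mapsto> (1 - p) / (1 - r * p)\<close> is an involution of the unit interval, so
  \<open>p_min\<close> is its value at the \<open>N\<close>-th root of \<open>\<tau>\<close>.\<close>

lemma single_trial_ratio_less_iff:
  fixes p q r :: real
  assumes "0 < r" "r < 1" "0 < p" "p < 1" "0 < q" "q < 1"
  shows "(1 - p) / (1 - r * p) < q \<longleftrightarrow> (1 - q) / (1 - r * q) < p"
    and "(1 - p) / (1 - r * p) = q \<longleftrightarrow> p = (1 - q) / (1 - r * q)"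
proof -
  have "r * p < 1" "r * q < 1" using assms mult_strict_mono[of r 1 _ 1] by simp_all
  then have "0 < 1 - r * p" "0 < 1 - r * q" by simp_all
  then show "(1 - p) / (1 - r * p) < q \<longleftrightarrow> (1 - q) / (1 - r * q) < p"
    and "(1 - p) / (1 - r * p) = q \<longleftrightarrow> p = (1 - q) / (1 - r * q)"
    by (auto simp: field_simps)
qed

lemma single_trial_ratio_bounds:
  fixes p r :: real
  assumes "0 < r" "r < 1" "0 < p" "p < 1"
  shows "0 < (1 - p) / (1 - r * p)" "(1 - p) / (1 - r * p) < 1"
proof -
  have "r * p < p" "r * p < 1" using assms mult_strict_mono[of r 1 p 1] by simp_all
  with assms show "0 < (1 - p) / (1 - r * p)" "(1 - p) / (1 - r * p) < 1"
    by (simp_all add: divide_simps)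
qed

text \<open>The \<open>N\<close>-th root is written as an exponential so that it can be expanded in
  \<open>1 / N\<close> and compared through logarithms.\<close>

lemma power_eq_iff_eq_exp:
  fixes x \<tau> :: real
  assumes "0 < \<tau>" "0 < x" "1 \<le> N"
  shows "x ^ N = \<tau> \<longleftrightarrow> x = exp (ln \<tau> / real N)"
proof -
  have "x ^ N = \<tau> \<longleftrightarrow> real N * ln x = ln \<tau>"
    using assms by (simp flip: ln_realpow)
  also have "\<dots> \<longleftrightarrow> ln x = ln \<tau> / real N" using assms by (auto simp: field_simps)
  also have "\<dots> \<longleftrightarrow> x = exp (ln \<tau> / real N)" using assms by (metis exp_ln ln_exp)
  finally show ?thesis .
qed

text \<open>Take the root, then invert the single-trial ratio. With the range of \<open>p\<close>
  included on the left, this one equivalence settles both unique existence and the description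
  defining \<open>p_min\<close>.\<close>

lemma likelihood_ratio_eq_iff:
  assumes "0 < r" "r < 1" "0 < \<tau>" "\<tau> < 1" "1 \<le> N"
  shows "0 < p \<and> p < 1 \<and> likelihood_ratio r N p = \<tau> \<longleftrightarrow>
    p = (1 - exp (ln \<tau> / real N)) / (1 - r * exp (ln \<tau> / real N))"
    (is "_ \<longleftrightarrow> p = ?P")
proof -
  let ?s = "exp (ln \<tau> / real N)"
  have s: "0 < ?s" "?s < 1" using assms by (simp_all add: divide_neg_pos)
  have P: "0 < ?P" "?P < 1" using single_trial_ratio_bounds[OF assms(1,2) s] .
  have "likelihood_ratio r N p = \<tau> \<longleftrightarrow> p = ?P" if "0 < p" "p < 1"
    using that assms s
    by (simp add: likelihood_ratio_eq power_eq_iff_eq_exp single_trial_ratio_bounds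
        single_trial_ratio_less_iff(2))
  with P show ?thesis by blast
qed

lemma p_min_eq:
  assumes "0 < r" "r < 1" "0 < \<tau>" "\<tau> < 1" "1 \<le> N"
  shows "p_min \<tau> N r = (1 - exp (ln \<tau> / real N)) / (1 - r * exp (ln \<tau> / real N))"
  unfolding p_min_def likelihood_ratio_eq_iff[OF assms] by simp

text \<open>In the closed form the numerator behaves like \<open>- ln \<tau> / N\<close> and the
  denominator tends to \<open>1 - r\<close>.\<close>

lemma p_min_asymp:
  assumes "0 < r" "r < 1" "0 < \<tau>" "\<tau> < 1"
  shows "(\<lambda>N. p_min \<tau> N r / (- ln \<tau> / (real N * (1 - r)))) \<longlonglongrightarrow> 1"
proof -
  define L where "L = ln \<tau>"
  have L: "L < 0" using assms by (simp add: L_def)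
  have "(\<lambda>N. ((1 - exp (L / real N)) / (1 - r * exp (L / real N))) /
      (- L / (real N * (1 - r)))) \<longlonglongrightarrow> 1"
    using L assms(1,2) by (real_asymp simp: field_simps)
  then show ?thesis
    by (rule Lim_transform_eventually)
      (auto intro!: eventually_sequentiallyI[of 1] simp: p_min_eq[OF assms] L_def)
qed

lemma required_trials_bounds:
  assumes "0 < r" "r < 1" "0 < \<tau>" "\<tau> < 1" "0 < p" "p < 1"
  shows "1 \<le> required_trials \<tau> r p"
    and "likelihood_ratio r (nat (required_trials \<tau> r p)) p \<le> \<tau>"
    and "1 \<le> N \<Longrightarrow> p_min \<tau> N r < p \<Longrightarrow> required_trials \<tau> r p \<le> int N"
    and "real_of_int (required_trials \<tau> r p) \<le> (1 - ln \<tau> / (1 - r)) / p"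
proof -
  define q where "q = (1 - p) / (1 - r * p)"
  have q: "0 < q" "q < 1"
    unfolding q_def using single_trial_ratio_bounds assms by blast+
  have n: "required_trials \<tau> r p = \<lceil>ln \<tau> / ln q\<rceil>"
    by (simp add: required_trials_def q_def)
  have lnq: "ln q < 0" and ln\<tau>: "ln \<tau> < 0" using q assms by simp_all
  then have "0 < ln \<tau> / ln q" by (simp add: divide_neg_neg)
  then show n1: "1 \<le> required_trials \<tau> r p" unfolding n by linarith

  let ?n = "nat (required_trials \<tau> r p)"
  \<comment> \<open>By \<open>n1\<close> the conversion to \<open>nat\<close> keeps the value.
    Multiplying by the negative \<open>ln q\<close> then reverses the inequality.\<close>
  have "ln \<tau> / ln q \<le> real ?n" using n1 n by linarith
  then have "ln (q ^ ?n) \<le> ln \<tau>"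
    using lnq q by (simp add: ln_realpow neg_divide_le_eq)
  then have "q ^ ?n \<le> \<tau>" using q assms by simp
  then show "likelihood_ratio r ?n p \<le> \<tau>"
    using assms by (simp add: likelihood_ratio_eq q_def)

  show "required_trials \<tau> r p \<le> int N" if N: "1 \<le> N" and "p_min \<tau> N r < p"
  proof -
    let ?s = "exp (ln \<tau> / real N)"
    have "0 < ?s" "?s < 1" using N ln\<tau> by (simp_all add: divide_neg_pos)
    \<comment> \<open>\<open>p_min\<close> is the image of \<open>?s\<close> under the decreasing
      involution, so \<open>p_min < p\<close> becomes \<open>q < ?s\<close>.\<close>
    with that assms have "q < ?s"
      unfolding q_def by (simp add: p_min_eq single_trial_ratio_less_iff(1))
    then have "ln q < ln \<tau> / real N" using q by (metis ln_exp ln_less_cancel_iff exp_gt_zero)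
    then have "ln \<tau> / ln q \<le> real N"
      using N lnq by (simp add: field_simps)
    then show ?thesis unfolding n by (simp add: ceiling_le_iff)
  qed

  have rp: "0 < r * p" "r * p < 1" using assms mult_strict_mono[of r 1 p 1] by simp_all
  have "ln q \<le> q - 1" using q ln_le_minus_one by blast
  also have "q - 1 = - ((1 - r) * p / (1 - r * p))"
    using rp(2) unfolding q_def by (simp add: divide_simps) (simp add: algebra_simps)
  also have "\<dots> \<le> - ((1 - r) * p)"
    using rp assms by (simp add: le_divide_eq)
  finally have "(1 - r) * p \<le> - ln q" by simp
  then have "- ln \<tau> / - ln q \<le> - ln \<tau> / ((1 - r) * p)"
    using assms ln\<tau> lnq by (intro divide_left_mono mult_pos_pos) auto
  \<comment> \<open>The ceiling costs less than 1, which \<open>1 / p\<close> absorbs; hence the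
    summand 1 in the constant \<open>1 - ln \<tau> / (1 - r)\<close>.\<close>
  moreover have "1 \<le> 1 / p" using assms by simp
  ultimately have "ln \<tau> / ln q + 1 \<le> (1 - ln \<tau> / (1 - r)) / p"
    by (simp add: diff_divide_distrib)
  then show "real_of_int (required_trials \<tau> r p) \<le> (1 - ln \<tau> / (1 - r)) / p"
    unfolding n by linarith
qed

theorem theorem1:
  fixes \<tau> r :: real
  assumes "0 < \<tau>" and "\<tau> < 1" and "0 < r" and "r < 1"
  shows
    "(\<forall>n::nat. \<forall>p::real. 0 < p \<and> p < 1 \<longrightarrow>
        likelihood_ratio r n p = ((1 - p) / (1 - r * p)) ^ n \<and>
        (\<forall>O0>0. prior_odds O0 r n p = O0 \<and>
                 posterior_odds O0 r n p = O0 * likelihood_ratio r n p) \<and>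
        (likelihood_ratio r n p \<le> \<tau> \<longleftrightarrow> (\<forall>O0>0. posterior_odds O0 r n p \<le> \<tau> * O0)))
     \<and> (\<forall>N_max::nat. N_max \<ge> 1 \<longrightarrow>
          (\<exists>!p. 0 < p \<and> p < 1 \<and> likelihood_ratio r N_max p = \<tau>) \<and>
          (\<forall>p. 0 < p \<and> p < 1 \<and> p > p_min \<tau> N_max r \<longrightarrow>
             1 \<le> required_trials \<tau> r p \<and>
             required_trials \<tau> r p \<le> int N_max \<and>
             likelihood_ratio r (nat (required_trials \<tau> r p)) p \<le> \<tau> \<and>
             (\<forall>O0>0. posterior_odds O0 r (nat (required_trials \<tau> r p)) p \<le> \<tau> * O0)))
     \<and> ((\<lambda>N_max. p_min \<tau> N_max r / (- ln \<tau> / (real N_max * (1 - r)))) \<longlonglongrightarrow> 1)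
     \<and> (\<exists>C::real. \<forall>p. 0 < p \<and> p < 1 \<longrightarrow> real_of_int (required_trials \<tau> r p) \<le> C / p)"
proof (intro conjI allI impI)
  note r = assms(3,4)
  fix n :: nat and p :: real
  assume p: "0 < p \<and> p < 1"
  then show "likelihood_ratio r n p = ((1 - p) / (1 - r * p)) ^ n"
    using r by (simp add: likelihood_ratio_eq)
  show "likelihood_ratio r n p \<le> \<tau> \<longleftrightarrow> (\<forall>O0>0. posterior_odds O0 r n p \<le> \<tau> * O0)"
    using r p by (intro likelihood_ratio_le_iff) auto
  fix O0 :: real
  assume "0 < O0"
  then show "prior_odds O0 r n p = O0"
    and "posterior_odds O0 r n p = O0 * likelihood_ratio r n p"
    using r p by (simp_all add: prior_odds_eq posterior_odds_eq)
next
  fix N :: nat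
  assume N: "1 \<le> N"
  show "\<exists>!p. 0 < p \<and> p < 1 \<and> likelihood_ratio r N p = \<tau>"
    unfolding likelihood_ratio_eq_iff[OF assms(3,4,1,2) N] by simp
  fix p :: real
  assume "0 < p \<and> p < 1 \<and> p_min \<tau> N r < p"
  then have p: "0 < p" "p < 1" "p_min \<tau> N r < p" by auto
  note b = required_trials_bounds[OF assms(3,4,1,2) p(1,2)]
  show "1 \<le> required_trials \<tau> r p" "required_trials \<tau> r p \<le> int N"
    and le: "likelihood_ratio r (nat (required_trials \<tau> r p)) p \<le> \<tau>"
    using b N p by auto
  fix O0 :: real
  assume "0 < O0"
  with le show "posterior_odds O0 r (nat (required_trials \<tau> r p)) p \<le> \<tau> * O0"
    using likelihood_ratio_le_iff[OF assms(3,4) p(1,2)] by blast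
next
  show "(\<lambda>N. p_min \<tau> N r / (- ln \<tau> / (real N * (1 - r)))) \<longlonglongrightarrow> 1"
    using p_min_asymp assms by blast
next
  show "\<exists>C::real. \<forall>p. 0 < p \<and> p < 1 \<longrightarrow> real_of_int (required_trials \<tau> r p) \<le> C / p"
    using required_trials_bounds(4) assms by blast
qed

end
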